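(* Let $P\in\mathbb{Z}_{\ge 1}$, let $G$ be the transfer function of a causal discrete-time LTI system with impulse response $g\not\equiv 0$, let $\psi:\mathbb{R}\to\mathbb{R}$ be a memoryless feedback function, let $H=H_{\overline g^P}$ be the associated $P\times P$ circulant matrix, and let $r=\operatorname{rank}(H)$. If $u^P\in\mathbb{R}^P\setminus\{0\}$ is a nontrivial $P$-periodic fixed-point, i.e. $u^P=-H\,\psi(u^P)$, and $u_{\ker}\in\ker(H)$ is a vector satisfying $\psi(u^P)=-H^{\dagger}u^P+u_{\ker}$, then $$\frac{\|u^P\|_2^2}{\sigma_1(H)^2}\;\le\;\|\psi(u^P)\|_2^2-\|u_{\ker}\|_2^2\;\le\;\frac{\|u^P\|_2^2}{\sigma_r(H)^2}.$$
   Context: System: a scalar, finite-dimensional, causal discrete-time linear time-invariant system (stable or unstable) with real impulse response $g$ and proper rational transfer function $G(z)=\sum_{t\ge 0}g(t)z^{-t}$ with real coefficients, evaluated as a rational function and assumed to have no pole at a $P$-th root of unity. Memoryless means that $\psi:\mathbb{R}\to\mathbb{R}$ is an arbitrary function (no continuity assumed); $\psi(v)$ for $v\in\mathbb{R}^P$ is applied entrywise. Circulant matrix: let $F_P=\big(e^{-2\pi j kl/P}\big)_{k,l=0}^{P-1}$ be the DFT matrix ($j$ is the imaginary unit), $\Lambda_G^P=\operatorname{diag}\big(G(1),G(e^{-2\pi j/P}),\dots,G(e^{-2(P-1)\pi j/P})\big)$, and $\overline g^P=F_P^{-1}\Lambda_G^P\mathbf{1}_P\in\mathbb{R}^P$,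 where $\mathbf 1_P$ is the all-ones vector. Then $H_{\overline g^P}:=F_P^{-1}\Lambda_G^P F_P$, which is the circulant matrix with first column $\overline g^P$. $H^\dagger$ denotes the Moore–Penrose inverse. For a matrix $M$ of rank $r$, $\sigma_1(M)\ge\dots\ge\sigma_r(M)>0$ denote its positive singular values in descending order (if $r=0$ there is no nontrivial fixed-point and nothing is claimed). A nontrivial $P$-periodic fixed-point is a nonzero $P$-periodic real sequence $u$, identified with its one-period vector $u^P=(u(0),\dots,u(P-1))^\top$, satisfying $u^P=-H_{\overline g^P}\psi(u^P)$. *)

theory Defs
  imports
    "HOL-Computational_Algebra.Computational_Algebra"
    "HOL-Computational_Algebra.Field_as_Ring"
    "Jordan_Normal_Form.Char_Poly"
    "Jordan_Normal_Form.Matrix_Kernel"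
    "Jordan_Normal_Form.DL_Rank"
    "Jordan_Normal_Form.Gauss_Jordan_Elimination"
begin

section \<open>Rational transfer functions\<close>

text \<open>A rational function with real coefficients is an element of the fraction field of the real
  polynomials. It is evaluated through its representation in lowest terms, so that cancelled
  factors of the denominator do not count as poles.\<close>

definition rat_num :: "real poly fract \<Rightarrow> complex poly" where
  "rat_num G = map_poly complex_of_real (fst (quot_of_fract G))"

definition rat_den :: "real poly fract \<Rightarrow> complex poly" where
  "rat_den G = map_poly complex_of_real (snd (quot_of_fract G))"

definition rat_eval :: "real poly fract \<Rightarrow> complex \<Rightarrow> complex" where
  "rat_eval G z = poly (rat_num G) z / poly (rat_den G) z"

definition rat_pole :: "real poly fract \<Rightarrow> complex \<Rightarrow> bool" where
  "rat_pole G z \<longleftrightarrow> poly (rat_den G) z = 0"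

definition rat_proper :: "real poly fract \<Rightarrow> bool" where
  "rat_proper G \<longleftrightarrow> degree (rat_num G) \<le> degree (rat_den G)"

text \<open>The system may be unstable, so \<open>G(z) = \<Sum>\<^sub>t g(t) z\<^sup>-\<^sup>t\<close> is required near infinity only; elsewhere
  \<open>G\<close> is given by \<^const>\<open>rat_eval\<close>.\<close>

definition is_transfer_function :: "(nat \<Rightarrow> real) \<Rightarrow> real poly fract \<Rightarrow> bool" where
  "is_transfer_function g G \<longleftrightarrow> rat_proper G \<and>
     (\<forall>\<^sub>F z in at_infinity. (\<lambda>t. complex_of_real (g t) / z ^ t) sums rat_eval G z)"

section \<open>The circulant matrix of a transfer function\<close>

definition dft_mat :: "nat \<Rightarrow> complex mat" where
  "dft_mat P = mat P P (\<lambda>(k, l). exp (- 2 * of_real pi * \<i> * of_nat k * of_nat l / of_nat P))"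

definition dft_diag :: "nat \<Rightarrow> real poly fract \<Rightarrow> complex mat" where
  "dft_diag P G = mat_diag P (\<lambda>k. rat_eval G (exp (- 2 * of_real pi * \<i> * of_nat k / of_nat P)))"

definition circulant_complex :: "nat \<Rightarrow> real poly fract \<Rightarrow> complex mat" where
  "circulant_complex P G = the (mat_inverse (dft_mat P)) * dft_diag P G * dft_mat P"

text \<open>Taking real parts only changes the type: the matrix already has real entries, by the lemma
  \<open>map_mat_of_real_circulant_mat\<close> below.\<close>

definition circulant_mat :: "nat \<Rightarrow> real poly fract \<Rightarrow> real mat" where
  "circulant_mat P G = map_mat Re (circulant_complex P G)"

definition dft_inv_mat :: "nat \<Rightarrow> complex mat" where
  "dft_inv_mat P = mat P P (\<lambda>(k, l). exp (2 * of_real pi * \<i> * of_nat k * of_nat l / of_nat P) / of_nat P)"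

lemma exp_two_pi_i_eq_1_iff: "exp (2 * of_real pi * \<i> * of_real x) = 1 \<longleftrightarrow> x \<in> \<int>"
proof -
  have "exp (2 * of_real pi * \<i> * of_real x) = cis (2 * pi * x)"
    by (simp add: cis_conv_exp mult_ac)
  moreover have "cis (2 * pi * x) = 1 \<longleftrightarrow> x \<in> \<int>"
  proof
    assume "cis (2 * pi * x) = 1"
    then have "cos (2 * pi * x) = 1" by (simp add: complex_eq_iff)
    then obtain n :: int where "2 * pi * x = real_of_int n * 2 * pi"
      by (auto simp: cos_one_2pi_int)
    then have "x = real_of_int n" by simp
    then show "x \<in> \<int>" by simp
  qed (rule cis_multiple_2pi)
  ultimately show ?thesis by simp
qed

lemma dft_mat_mult_dft_inv_mat:
  assumes "P \<ge> 1"
  shows "dft_mat P * dft_inv_mat P = 1\<^sub>m P"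
proof (rule eq_matI)
  fix k l assume "k < dim_row (1\<^sub>m P :: complex mat)" "l < dim_col (1\<^sub>m P :: complex mat)"
  then have kl: "k < P" "l < P" by auto
  define w :: complex where "w = exp (2 * of_real pi * \<i> * (of_nat l - of_nat k) / of_nat P)"
  have P0: "(of_nat P :: complex) \<noteq> 0" using assms by simp
  have "(dft_mat P * dft_inv_mat P) $$ (k, l) = (\<Sum>m = 0..<P. w ^ m / of_nat P)"
    using kl P0
    by (simp add: dft_mat_def dft_inv_mat_def scalar_prod_def w_def exp_of_nat_mult[symmetric]
        exp_add[symmetric] field_simps)
  also have "\<dots> = (\<Sum>m<P. w ^ m) / of_nat P"
    by (simp add: sum_divide_distrib atLeast0LessThan)
  also have "\<dots> = (if k = l then 1 else 0)"
  proof (cases "k = l")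
    case True
    then show ?thesis using P0 by (simp add: w_def)
  next
    case False
    have "w \<noteq> 1"
    proof
      assume "w = 1"
      then have "(real l - real k) / real P \<in> \<int>"
        using exp_two_pi_i_eq_1_iff[of "(real l - real k) / real P"] by (simp add: w_def)
      then obtain n :: int where "(real l - real k) / real P = real_of_int n"
        by (elim Ints_cases)
      then have "real l - real k = real_of_int n * real P"
        using assms by (simp add: field_simps)
      then have "real_of_int (int l - int k) = real_of_int (n * int P)" by simp
      then have e: "int l - int k = n * int P" by (simp only: of_int_eq_iff)
      have "\<bar>int l - int k\<bar> < int P" using kl by auto
      then have "\<bar>n\<bar> * int P < 1 * int P" unfolding e by (simp add: abs_mult)
      then have "n = 0" by (subst (asm) mult_less_cancel_right) auto
      with e False show False by simp
    qed
    moreover have "w ^ P = exp (2 * of_real pi * \<i> * of_real (of_int (int l - int k)))"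
      using P0 by (simp add: w_def exp_of_nat_mult[symmetric] field_simps)
    then have "w ^ P = 1"
      by (simp only: exp_two_pi_i_eq_1_iff Ints_of_int)
    ultimately show ?thesis using False by (simp add: geometric_sum)
  qed
  finally show "(dft_mat P * dft_inv_mat P) $$ (k, l) = 1\<^sub>m P $$ (k, l)" using kl by simp
qed (auto simp: dft_mat_def dft_inv_mat_def)

lemma mat_inverse_dft_mat:
  assumes "P \<ge> 1"
  shows "mat_inverse (dft_mat P) = Some (dft_inv_mat P)"
proof -
  have c: "dft_mat P \<in> carrier_mat P P" "dft_inv_mat P \<in> carrier_mat P P"
    by (auto simp: dft_mat_def dft_inv_mat_def)
  note r = dft_mat_mult_dft_inv_mat[OF assms]
  note l = mat_mult_left_right_inverse[OF c r]
  have "dft_mat P \<in> Units (ring_mat TYPE(complex) P ())"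
    using c r l by (auto simp: Units_def ring_mat_def)
  then obtain B where B: "mat_inverse (dft_mat P) = Some B"
    using mat_inverse(1)[OF c(1), where b = "()"] by (cases "mat_inverse (dft_mat P)") auto
  note b = mat_inverse(2)[OF c(1) B]
  have "B = dft_inv_mat P * dft_mat P * B" using b l left_mult_one_mat[of B P P] by simp
  also have "\<dots> = dft_inv_mat P * (dft_mat P * B)" using b c by (intro assoc_mult_mat) auto
  also have "\<dots> = dft_inv_mat P" using b c by simp
  finally show ?thesis using B by simp
qed

lemma cnj_rat_eval: "cnj (rat_eval G z) = rat_eval G (cnj z)"
  by (simp add: rat_eval_def rat_num_def rat_den_def poly_cnj map_poly_map_poly o_def)

lemma map_mat_of_real_circulant_mat:
  assumes "P \<ge> 1"
  shows "map_mat complex_of_real (circulant_mat P G) = circulant_complex P G"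
proof (rule eq_matI)
  define e where "e = (\<lambda>x :: int. exp (2 * of_real pi * \<i> * of_int x / of_nat P))"
  have P0: "(of_nat P :: complex) \<noteq> 0" using assms by simp
  have e_add: "e (x + y) = e x * e y" for x y
    by (simp add: e_def exp_add[symmetric] add_divide_distrib[symmetric] algebra_simps)
  have e_P: "e (int P * y) = 1" for y
    using P0 exp_two_pi_i_eq_1_iff[of "of_int y"] by (simp add: e_def mult.assoc)
  have e_cnj: "cnj (e x) = e (- x)" for x
  proof -
    have "e y = cis (2 * pi * of_int y / of_nat P)" for y
      by (simp add: e_def cis_conv_exp mult_ac)
    then show ?thesis by (simp add: cis_cnj)
  qed
  have C: "circulant_complex P G = dft_inv_mat P * dft_diag P G * dft_mat P"
    unfolding circulant_complex_def mat_inverse_dft_mat[OF assms] by simp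
  have dim: "dim_row (circulant_complex P G) = P" "dim_col (circulant_complex P G) = P"
    unfolding C by (simp_all add: dft_inv_mat_def dft_mat_def)
  fix i j assume "i < dim_row (circulant_complex P G)" "j < dim_col (circulant_complex P G)"
  then have ij: "i < P" "j < P"
    unfolding dim by auto
  define d where "d = int i - int j"
  define f where "f = (\<lambda>m :: nat. rat_eval G (e (- int m)) * e (int m * d) / of_nat P)"
  have eq: "circulant_complex P G $$ (i, j) = (\<Sum>m<P. f m)"
  proof -
    have "circulant_complex P G $$ (i, j) =
      (\<Sum>m = 0..<P. dft_inv_mat P $$ (i, m) * rat_eval G (e (- int m)) * dft_mat P $$ (m, j))"
      using ij
      unfolding C dft_diag_def
      by (subst mat_diag_mult_right[of _ P], auto simp: dft_inv_mat_def dft_mat_def scalar_prod_def e_def)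
    also have "\<dots> = (\<Sum>m<P. f m)"
      unfolding atLeast0LessThan
    proof (rule sum.cong[OF refl])
      fix m assume "m \<in> {..<P}"
      then have m: "m < P" by simp
      have 1: "dft_inv_mat P $$ (i, m) = e (int i * int m) / of_nat P"
        using ij m by (simp add: dft_inv_mat_def e_def mult.assoc)
      have 2: "dft_mat P $$ (m, j) = e (- (int m * int j))"
        using ij m by (simp add: dft_mat_def e_def mult.assoc)
      have "e (int i * int m) * e (- (int m * int j)) = e (int m * d)"
        by (simp add: e_add[symmetric] d_def algebra_simps)
      then show "dft_inv_mat P $$ (i, m) * rat_eval G (e (- int m)) * dft_mat P $$ (m, j) = f m"
        unfolding 1 2 f_def by (simp add: field_simps)
    qed
    finally show ?thesis .
  qed
  define s where "s = (\<lambda>m. (P - m) mod P)"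
  have fs: "f (s m) = cnj (f m)" if "m < P" for m
  proof (cases "m = 0")
    case True
    have "e 0 = 1" by (simp add: e_def)
    then show ?thesis using True by (simp add: s_def f_def cnj_rat_eval)
  next
    case False
    with that have sm: "int (s m) = int P - int m" by (simp add: s_def)
    have "e (- int (s m)) = e (int P * (- 1)) * e (int m)"
      unfolding e_add[symmetric] sm by simp
    moreover have "e (int (s m) * d) = e (int P * d) * e (- (int m * d))"
      unfolding e_add[symmetric] sm by (simp add: algebra_simps)
    ultimately show ?thesis
      unfolding f_def e_P by (simp add: e_cnj cnj_rat_eval)
  qed
  have "(\<Sum>m<P. cnj (f m)) = (\<Sum>m<P. f m)"
  proof (rule sum.reindex_bij_witness[of _ s s])
    fix m assume "m \<in> {..<P}"
    then have m: "m < P" by simp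
    show "f (s m) = cnj (f m)" by (rule fs[OF m])
    show "s m \<in> {..<P}" using m by (simp add: s_def)
    show "s (s m) = m" using m by (cases "m = 0") (simp_all add: s_def)
    then show "s (s m) = m" .
    show "s m \<in> {..<P}" using m by (simp add: s_def)
  qed
  then have "cnj (circulant_complex P G $$ (i, j)) = circulant_complex P G $$ (i, j)"
    by (simp add: eq)
  then have "complex_of_real (Re (circulant_complex P G $$ (i, j))) = circulant_complex P G $$ (i, j)"
    by (simp add: complex_eq_iff)
  then show "map_mat complex_of_real (circulant_mat P G) $$ (i, j) = circulant_complex P G $$ (i, j)"
    using ij by (simp add: circulant_mat_def dim)
qed (auto simp: circulant_mat_def)

section \<open>Moore--Penrose inverse, singular values, Euclidean norm\<close>

definition is_pseudoinverse :: "real mat \<Rightarrow> real mat \<Rightarrow> bool" where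
  "is_pseudoinverse A X \<longleftrightarrow> X \<in> carrier_mat (dim_col A) (dim_row A) \<and>
     A * X * A = A \<and> X * A * X = X \<and>
     transpose_mat (A * X) = A * X \<and> transpose_mat (X * A) = X * A"

definition pseudoinverse :: "real mat \<Rightarrow> real mat" where
  "pseudoinverse A = (THE X. is_pseudoinverse A X)"

text \<open>The positive singular values \<open>\<sigma>\<^sub>1 \<ge> \<dots> \<ge> \<sigma>\<^sub>r > 0\<close>: the square roots of the positive eigenvalues of
  \<open>M\<^sup>T M\<close>, repeated according to multiplicity.\<close>

definition singular_values :: "real mat \<Rightarrow> real list" where
  "singular_values M = rev (sorted_list_of_multiset
     (image_mset sqrt (filter_mset (\<lambda>x. x > 0) (proots (char_poly (transpose_mat M * M))))))"

definition singular_value :: "nat \<Rightarrow> real mat \<Rightarrow> real" where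
  "singular_value i M = singular_values M ! (i - 1)"

definition vec_norm2 :: "real vec \<Rightarrow> real" where
  "vec_norm2 v = sqrt (v \<bullet> v)"

end

theory Submission
  imports Defs
begin

text \<open>Put \<open>x = - H\<^sup>\<dagger> u\<close>. Since \<open>H\<^sup>\<dagger> H\<close> is symmetric and fixes \<open>x\<close>, the vector \<open>x\<close> is orthogonal to
  \<open>ker H\<close>, so \<open>\<parallel>\<psi>(u)\<parallel>\<^sup>2 - \<parallel>u\<^sub>k\<^sub>e\<^sub>r\<parallel>\<^sup>2 = \<parallel>x\<parallel>\<^sup>2\<close>, while \<open>u = - H x\<close>. If \<open>H\<^sup>T H\<close> is orthogonally
  diagonalised with eigenvalues \<open>\<mu>\<^sub>i\<close>, then \<open>\<parallel>u\<parallel>\<^sup>2 = \<Sum>\<^sub>i \<mu>\<^sub>i y\<^sub>i\<^sup>2\<close> for the coordinates \<open>y\<close> of \<open>x\<close>, which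
  vanish where \<open>\<mu>\<^sub>i = 0\<close>; hence \<open>\<sigma>\<^sub>r\<^sup>2 \<parallel>x\<parallel>\<^sup>2 \<le> \<parallel>u\<parallel>\<^sup>2 \<le> \<sigma>\<^sub>1\<^sup>2 \<parallel>x\<parallel>\<^sup>2\<close>. For the circulant matrix a real
  orthogonal diagonalisation of \<open>H\<^sup>T H\<close> is explicit: \<open>\<mu>\<^sub>k = |G(e\<^sup>-\<^sup>2\<^sup>\<pi>\<^sup>i\<^sup>k\<^sup>/\<^sup>P)|\<^sup>2\<close> is even in \<open>k\<close> modulo
  \<open>P\<close>, so the complex Fourier basis can be replaced by the real Hartley basis
  \<open>cos(2\<pi>kl/P) + sin(2\<pi>kl/P)\<close>.\<close>

section \<open>The Moore--Penrose inverse\<close>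

text \<open>Penrose's argument: inserting one inverse into the other and transposing the symmetric
  products gives \<open>A * X = A * Y\<close> and \<open>X * A = Y * A\<close>, whence
  \<open>X = X * A * X = X * A * Y = Y * A * Y = Y\<close>.\<close>

lemma is_pseudoinverse_unique:
  assumes X: "is_pseudoinverse A X" and Y: "is_pseudoinverse A Y"
  shows "X = Y"
proof -
  define m n where "m = dim_row A" and "n = dim_col A"
  have A: "A \<in> carrier_mat m n" by (simp add: m_def n_def)
  have cX: "X \<in> carrier_mat n m" and AXA: "A * X * A = A" and XAX: "X * A * X = X"
    and AX: "transpose_mat (A * X) = A * X" and XA: "transpose_mat (X * A) = X * A"
    using X by (auto simp: is_pseudoinverse_def m_def n_def)
  have cY: "Y \<in> carrier_mat n m" and AYA: "A * Y * A = A" and YAY: "Y * A * Y = Y"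
    and AY: "transpose_mat (A * Y) = A * Y" and YA: "transpose_mat (Y * A) = Y * A"
    using Y by (auto simp: is_pseudoinverse_def m_def n_def)
  note [simp] = assoc_mult_mat[of _ m n _ m _ n] assoc_mult_mat[of _ m n _ m _ m]
    assoc_mult_mat[of _ m m _ n _ m] assoc_mult_mat[of _ n m _ n _ m] assoc_mult_mat[of _ n m _ n _ n]
    assoc_mult_mat[of _ n n _ m _ n] assoc_mult_mat[of _ n n _ m _ m] assoc_mult_mat[of _ m m _ m _ n] assoc_mult_mat[of _ m n _ n _ m] assoc_mult_mat[of _ n m _ m _ n]
    mult_carrier_mat[of _ m n _ m] mult_carrier_mat[of _ n m _ n]
  have "A * X = A * Y * A * X" by (simp only: AYA)
  also have "\<dots> = transpose_mat (A * Y) * transpose_mat (A * X)"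
    unfolding AX AY using A cX cY by simp
  also have "\<dots> = transpose_mat (A * X * (A * Y))"
    using A cX cY by (intro transpose_mult[symmetric]) auto
  also have "A * X * (A * Y) = A * X * A * Y" using A cX cY by simp
  also have "\<dots> = A * Y" by (simp only: AXA)
  finally have 1: "A * X = A * Y" unfolding AY .
  have "X * A = X * (A * Y * A)" by (simp only: AYA)
  also have "\<dots> = transpose_mat (X * A) * transpose_mat (Y * A)"
    unfolding XA YA using A cX cY by simp
  also have "\<dots> = transpose_mat (Y * A * (X * A))"
    using A cX cY by (intro transpose_mult[symmetric]) auto
  also have "Y * A * (X * A) = Y * (A * X * A)" using A cX cY by simp
  also have "\<dots> = Y * A" by (simp only: AXA)
  finally have 2: "X * A = Y * A" unfolding YA .
  have "X = X * A * X" by (simp only: XAX)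
  also have "\<dots> = X * (A * X)" using A cX by simp
  also have "\<dots> = X * A * Y" unfolding 1 using A cX cY by simp
  also have "\<dots> = Y" by (simp only: 2 YAY)
  finally show ?thesis .
qed

text \<open>By uniqueness, the definite description denotes as soon as one witness exists.\<close>

lemma is_pseudoinverse_pseudoinverse:
  assumes "is_pseudoinverse A X"
  shows "is_pseudoinverse A (pseudoinverse A)"
  unfolding pseudoinverse_def
  by (rule theI[where P = "is_pseudoinverse A", OF assms]) (rule is_pseudoinverse_unique[OF _ assms])

section \<open>Matrices whose Gram matrix is orthogonally diagonalised\<close>

lemma real_scalar_prod_self_nonneg: "0 \<le> v \<bullet> (v :: real vec)"
  by (simp add: scalar_prod_def sum_nonneg)

lemma real_scalar_prod_self_eq_0_iff:
  fixes v :: "real vec"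
  assumes "v \<in> carrier_vec n"
  shows "v \<bullet> v = 0 \<longleftrightarrow> v = 0\<^sub>v n"
  using assms by (auto simp: scalar_prod_def sum_nonneg_eq_0_iff)

lemma vec_norm2_sq: "(vec_norm2 v)\<^sup>2 = v \<bullet> v"
  by (simp add: vec_norm2_def real_scalar_prod_self_nonneg)

lemma transpose_mat_diag [simp]: "transpose_mat (mat_diag n f) = mat_diag n f"
  by (rule eq_matI) (auto simp: mat_diag_def)

lemma mat_diag_mult_vec:
  assumes "v \<in> carrier_vec n"
  shows "mat_diag n f *\<^sub>v v = vec n (\<lambda>i. f i * v $ i)"
proof (rule eq_vecI, insert assms, auto simp: mat_diag_def scalar_prod_def, goal_cases)
  case (1 i)
  then show ?case by (subst sum.remove[of _ i]) auto
qed

lemma scalar_prod_mult_mat_vec: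
  fixes A :: "'a :: comm_semiring_0 mat"
  assumes "A \<in> carrier_mat m n" "v \<in> carrier_vec n" "w \<in> carrier_vec m"
  shows "w \<bullet> (A *\<^sub>v v) = (transpose_mat A *\<^sub>v w) \<bullet> v"
  using assms transpose_vec_mult_scalar[of "transpose_mat A" n m w v] comm_scalar_prod[of w m "A *\<^sub>v v"]
    comm_scalar_prod[of v n "transpose_mat A *\<^sub>v w"]
  by simp

lemma mult_mat_vec_uminus:
  fixes A :: "'a :: ring mat"
  assumes "v \<in> carrier_vec (dim_col A)"
  shows "A *\<^sub>v (- v) = - (A *\<^sub>v v)"
  using assms by (intro eq_vecI) auto

section \<open>Rank of a matrix with orthogonal columns\<close>

text \<open>Pairing a vanishing combination with \<open>w\<close> isolates
  \<open>a w * (w \<bullet> w)\<close>. Over a general field a nonzero vector can be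
  self-orthogonal, so \<open>v \<bullet> v \<noteq> 0\<close> is assumed outright.\<close>

lemma (in vec_space) lin_indpt_of_pairwise_orthogonal:
  assumes S: "finite S" "S \<subseteq> carrier_vec n"
    and orth: "\<And>v w. v \<in> S \<Longrightarrow> w \<in> S \<Longrightarrow> v \<noteq> w \<Longrightarrow> v \<bullet> w = 0"
    and pos: "\<And>v. v \<in> S \<Longrightarrow> v \<bullet> v \<noteq> 0"
  shows "lin_indpt S"
proof
  assume "lin_dep S"
  then obtain a w where a: "lincomb a S = 0\<^sub>v n" "w \<in> S" "a w \<noteq> 0"
    using finite_lin_dep[OF S(1)] S(2) by auto
  have w: "w \<in> carrier_vec n" using a S by auto
  have "0 = lincomb a S \<bullet> w" using a w by simp
  also have "\<dots> = (\<Sum>v\<in>S. (a v \<cdot>\<^sub>v v) \<bullet> w)"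
    unfolding lincomb_def using S w by (intro finsum_scalar_prod_sum) auto
  also have "\<dots> = (\<Sum>v\<in>S. if v = w then a w * (w \<bullet> w) else 0)"
    using S w orth[OF _ a(2)] by (intro sum.cong) auto
  also have "\<dots> = a w * (w \<bullet> w)" using S a by simp
  finally show False using pos a by simp
qed

text \<open>The columns are pairwise orthogonal with squared lengths \<open>\<mu> i\<close>, so the
  nonzero ones form a maximal independent set of columns.\<close>

lemma rank_orthogonal_columns:
  fixes B :: "real mat"
  assumes B: "B \<in> carrier_mat m n" and gram: "transpose_mat B * B = mat_diag n \<mu>"
  shows "vec_space.rank m B = card {i. i < n \<and> \<mu> i \<noteq> 0}"
proof -
  interpret vec_space "TYPE(real)" m .
  define I where "I = {i. i < n \<and> \<mu> i \<noteq> 0}"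
  have ip: "col B i \<bullet> col B j = (if i = j then \<mu> j else 0)" if "i < n" "j < n" for i j
  proof -
    have "(transpose_mat B * B) $$ (i, j) = col B i \<bullet> col B j" using that B by simp
    then show ?thesis using that by (simp add: gram mat_diag_def)
  qed
  \<comment> \<open>Independence concerns the set of columns, while the claim counts
    indices.\<close>
  have inj: "inj_on (col B) I"
  proof (rule inj_onI, rule ccontr)
    fix i j assume "i \<in> I" "j \<in> I" "col B i = col B j" "i \<noteq> j"
    then show False using ip[of i j] ip[of j j] by (simp add: I_def)
  qed
  have set_cols: "set (cols B) = col B ` {..<n}"
    using B by (auto simp: cols_def)
  have sub: "col B ` I \<subseteq> set (cols B)" unfolding set_cols by (auto simp: I_def)
  have indpt: "lin_indpt (col B ` I)"
  proof (rule lin_indpt_of_pairwise_orthogonal)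
    show "col B ` I \<subseteq> carrier_vec m" using B by auto
  qed (auto simp: I_def ip split: if_splits)
  \<comment> \<open>Maximality: an independent set omits the zero vector, and the columns with
    \<open>\<mu> i = 0\<close> are zero.\<close>
  have "T = col B ` I" if T: "T \<subseteq> set (cols B)" "lin_indpt T" "col B ` I \<subseteq> T" for T
  proof -
    have "T \<subseteq> carrier_vec m" using T(1) B unfolding set_cols by auto
    moreover have "(UNIV :: real set) \<noteq> {0}" by (metis UNIV_I singletonD zero_neq_one)
    ultimately have "0\<^sub>v m \<notin> T" using zero_nin_lin_indpt[of T] T(2) by auto
    moreover have "col B i = 0\<^sub>v m" if "i < n" "\<mu> i = 0" for i
      using ip[of i i] that real_scalar_prod_self_eq_0_iff[of "col B i" m] B by auto
    ultimately have "T \<subseteq> col B ` I" using T(1) unfolding set_cols I_def by fastforce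
    with T(3) show ?thesis by simp
  qed
  then have "maximal (col B ` I) (\<lambda>T. T \<subseteq> set (cols B) \<and> lin_indpt T)"
    unfolding maximal_def using sub indpt by auto
  from rank_card_indpt[OF B this] show ?thesis
    by (simp add: card_image[OF inj] I_def[symmetric])
qed

text \<open>Since \<open>A x = (A Q) (R x)\<close>, multiplication by \<open>Q\<close> leaves the
  column space unchanged.\<close>

lemma rank_mult_right_inverse:
  fixes A :: "'a :: field mat"
  assumes A: "A \<in> carrier_mat m n" and Q: "Q \<in> carrier_mat n k" and R: "R \<in> carrier_mat k n"
    and QR: "Q * R = 1\<^sub>m n"
  shows "vec_space.rank m (A * Q) = vec_space.rank m A"
proof -
  interpret vec_space "TYPE('a)" m .
  have "col_space (A * Q) = col_space A"
  proof
    show "col_space (A * Q) \<subseteq> col_space A"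
      using A Q by (subst (1 2) col_space_eq) (auto simp: assoc_mult_mat_vec)
    have "\<exists>y \<in> carrier_vec k. A * Q *\<^sub>v y = A *\<^sub>v x" if x: "x \<in> carrier_vec n" for x
    proof
      show "R *\<^sub>v x \<in> carrier_vec k" using R x by simp
      have "A * Q *\<^sub>v (R *\<^sub>v x) = A *\<^sub>v (Q * R *\<^sub>v x)"
        using A Q R x by (simp add: assoc_mult_mat_vec)
      then show "A * Q *\<^sub>v (R *\<^sub>v x) = A *\<^sub>v x" using x by (simp add: QR)
    qed
    then show "col_space A \<subseteq> col_space (A * Q)"
      using A Q by (subst (1 2) col_space_eq) auto
  qed
  then show ?thesis by (simp add: rank_def col_space_def)
qed

text \<open>\<open>singular_value i\<close> reads position \<open>i - 1\<close> of a reversed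
  ascending list, so the extreme values sit at positions \<open>0\<close> and
  \<open>size M - 1\<close>.\<close>

lemma nth_rev_sorted_list_of_multiset:
  assumes "x \<in># M"
  shows "x \<le> rev (sorted_list_of_multiset M) ! 0"
    and "(rev (sorted_list_of_multiset M)) ! (size M - 1) \<le> x"
proof -
  define xs where "xs = sorted_list_of_multiset M"
  have xs: "sorted xs" "x \<in> set xs" "length xs = size M"
    using assms by (simp_all add: xs_def flip: size_mset)
  then obtain i where i: "i < length xs" "x = xs ! i" by (auto simp: in_set_conv_nth)
  have "rev xs ! 0 = xs ! (length xs - 1)" using i by (subst rev_nth) auto
  then show "x \<le> rev (sorted_list_of_multiset M) ! 0"
    unfolding xs_def[symmetric] using i xs by (auto intro: sorted_nth_mono)
  have "rev xs ! (size M - 1) = xs ! 0" unfolding xs(3)[symmetric] using i by (subst rev_nth) auto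
  then show "(rev (sorted_list_of_multiset M)) ! (size M - 1) \<le> x"
    unfolding xs_def[symmetric] using i xs by (auto intro: sorted_nth_mono)
qed

section \<open>Rank, singular values and pseudoinverse from an orthogonal diagonalisation\<close>

text \<open>The spectral data are assumed, so one explicit diagonalisation of the Gram matrix
  suffices for all that follows. The eigenvalues \<open>\<mu>\<close> may come in any order, repeat
  or vanish.\<close>

locale gram_diagonalization =
  fixes m n :: nat and A Q :: "real mat" and \<mu> :: "nat \<Rightarrow> real"
  assumes A: "A \<in> carrier_mat m n" and Q: "Q \<in> carrier_mat n n"
    and orthogonal: "transpose_mat Q * Q = 1\<^sub>m n"
    and gram: "transpose_mat A * A = Q * mat_diag n \<mu> * transpose_mat Q"
begin

lemma orthogonal': "Q * transpose_mat Q = 1\<^sub>m n"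
  using mat_mult_left_right_inverse[OF _ Q orthogonal] Q by simp

text \<open>Orthogonality of \<open>Q\<close> cancels the outer factors in \<open>gram\<close>.
  Hence the columns of \<open>A * Q\<close> are pairwise orthogonal with squared lengths
  \<open>\<mu> i\<close>.\<close>

lemma gram_mult: "transpose_mat (A * Q) * (A * Q) = mat_diag n \<mu>"
proof -
  note [simp] = assoc_mult_mat[of _ n n _ n _ n] assoc_mult_mat[of _ n m _ n _ n]
    assoc_mult_mat[of _ n n _ m _ n]
  have "transpose_mat (A * Q) * (A * Q) = transpose_mat Q * (transpose_mat A * A) * Q"
    using A Q by (simp add: transpose_mult[of _ m n _ n])
  also have "\<dots> = (transpose_mat Q * Q) * mat_diag n \<mu> * (transpose_mat Q * Q)"
    unfolding gram using Q by (simp add: mult_carrier_mat[of _ n n _ n])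
  finally show ?thesis by (simp add: orthogonal left_mult_one_mat[of _ n n] right_mult_one_mat[of _ n n])
qed

lemma eigenvalue_nonneg: "i < n \<Longrightarrow> 0 \<le> \<mu> i"
proof -
  assume i: "i < n"
  have "(transpose_mat (A * Q) * (A * Q)) $$ (i, i) = col (A * Q) i \<bullet> col (A * Q) i"
    using i A Q by simp
  then show ?thesis unfolding gram_mult
    using i real_scalar_prod_self_nonneg[of "col (A * Q) i"] by (simp add: mat_diag_def)
qed

lemma rank_eq: "vec_space.rank m A = card {i. i < n \<and> \<mu> i > 0}"
proof -
  have "vec_space.rank m A = vec_space.rank m (A * Q)"
    using rank_mult_right_inverse[OF A Q _ orthogonal'] Q by simp
  also have "\<dots> = card {i. i < n \<and> \<mu> i \<noteq> 0}"
    using A Q gram_mult by (intro rank_orthogonal_columns) auto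
  also have "{i. i < n \<and> \<mu> i \<noteq> 0} = {i. i < n \<and> \<mu> i > 0}"
    using eigenvalue_nonneg by force
  finally show ?thesis .
qed

text \<open>Similarity through \<open>Q\<close> preserves the characteristic polynomial, which for a
  diagonal matrix is a product of linear factors; \<open>proots\<close> keeps
  multiplicities.\<close>

lemma proots_gram: "proots (char_poly (transpose_mat A * A)) = image_mset \<mu> (mset_set {..<n})"
proof -
  have "similar_mat_wit (transpose_mat A * A) (mat_diag n \<mu>) Q (transpose_mat Q)"
    using A Q orthogonal orthogonal' gram by (intro similar_mat_witI) auto
  then have "similar_mat (transpose_mat A * A) (mat_diag n \<mu>)"
    unfolding similar_mat_def by blast
  then have "char_poly (transpose_mat A * A) = char_poly (mat_diag n \<mu>)"
    by (rule char_poly_similar)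
  also have "\<dots> = (\<Prod>a \<leftarrow> diag_mat (mat_diag n \<mu>). [:- a, 1:])"
    by (rule char_poly_upper_triangular[of _ n]) (auto simp: mat_diag_def)
  also have "diag_mat (mat_diag n \<mu>) = map \<mu> [0..<n]"
    by (auto simp: diag_mat_def mat_diag_def)
  also have "(\<Prod>a \<leftarrow> map \<mu> [0..<n]. [:- a, 1:]) = (\<Prod>i<n. [:- \<mu> i, 1:])"
    by (simp add: prod.list_conv_set_nth atLeast0LessThan)
  also have "proots \<dots> = (\<Sum>i<n. {#\<mu> i#})"
    by (subst proots_prod) auto
  finally show ?thesis by (simp add: sum_unfold_sum_mset)
qed

text \<open>The singular values are the numbers \<open>sqrt (\<mu> j)\<close> for positive
  \<open>\<mu> j\<close>, and by \<open>rank_eq\<close> their number is the rank, so the rank is the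
  index of the smallest one.\<close>

lemma singular_value_bounds:
  assumes i: "i < n" and pos: "\<mu> i > 0"
  shows "\<mu> i \<le> (singular_value 1 A)\<^sup>2"
    and "0 < singular_value (vec_space.rank m A) A"
    and "(singular_value (vec_space.rank m A) A)\<^sup>2 \<le> \<mu> i"
proof -
  define M where "M = image_mset sqrt (filter_mset (\<lambda>x. x > 0) (image_mset \<mu> (mset_set {..<n})))"
  have sv: "singular_values A = rev (sorted_list_of_multiset M)"
    by (simp add: singular_values_def M_def proots_gram)
  have M: "x \<in># M \<longleftrightarrow> (\<exists>j<n. \<mu> j > 0 \<and> x = sqrt (\<mu> j))" for x
    by (auto simp: M_def)
  have "size M = card {j. j < n \<and> \<mu> j > 0}"
    by (simp add: M_def filter_mset_image_mset)
  then have r: "vec_space.rank m A = size M" by (simp add: rank_eq)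
  have mem: "sqrt (\<mu> i) \<in># M" using assms M by auto
  have "sqrt (\<mu> i) \<le> singular_value 1 A"
    using nth_rev_sorted_list_of_multiset(1)[OF mem] by (simp add: singular_value_def sv)
  then show "\<mu> i \<le> (singular_value 1 A)\<^sup>2"
    using pos by (metis real_sqrt_le_iff real_sqrt_abs abs_ge_self order_trans)
  \<comment> \<open>\<open>M\<close> contains \<open>sqrt (\<mu> i)\<close>, so it is nonempty and
    the truncated difference is a valid position.\<close>
  have "size M - 1 < length (singular_values A)"
    using mem by (cases M) (auto simp: sv simp flip: size_mset)
  then have "singular_value (size M) A \<in> set (singular_values A)"
    unfolding singular_value_def by (rule nth_mem)
  then show *: "0 < singular_value (vec_space.rank m A) A"
    unfolding r by (auto simp: sv M)
  have "singular_value (vec_space.rank m A) A \<le> sqrt (\<mu> i)"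
    using nth_rev_sorted_list_of_multiset(2)[OF mem] by (simp add: singular_value_def sv r)
  then show "(singular_value (vec_space.rank m A) A)\<^sup>2 \<le> \<mu> i"
    using * pos by (metis less_imp_le power_mono real_sqrt_pow2)
qed

text \<open>The first identity is Parseval in the orthonormal basis of columns of \<open>Q\<close>;
  in the second, \<open>gram_mult\<close> makes the quadratic form diagonal.\<close>

lemma norm_mult_vec:
  fixes x y :: "real vec"
  assumes x: "x \<in> carrier_vec n"
  defines "y \<equiv> transpose_mat Q *\<^sub>v x"
  shows "x \<bullet> x = (\<Sum>i<n. (y $ i)\<^sup>2)"
    and "(A *\<^sub>v x) \<bullet> (A *\<^sub>v x) = (\<Sum>i<n. \<mu> i * (y $ i)\<^sup>2)"
proof -
  have y: "y \<in> carrier_vec n" using Q x by (simp add: y_def)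
  have xy: "Q *\<^sub>v y = x"
    using Q x by (simp add: y_def orthogonal' flip: assoc_mult_mat_vec)
  have "x \<bullet> x = y \<bullet> y"
    using scalar_prod_mult_mat_vec[OF Q y x] unfolding xy y_def[symmetric] .
  then show "x \<bullet> x = (\<Sum>i<n. (y $ i)\<^sup>2)"
    using y by (simp add: scalar_prod_def power2_eq_square atLeast0LessThan)
  have AQ: "A * Q \<in> carrier_mat m n" using A Q by simp
  have Ax: "A *\<^sub>v x = (A * Q) *\<^sub>v y"
    using A Q y by (simp add: xy assoc_mult_mat_vec)
  have "(A *\<^sub>v x) \<bullet> (A *\<^sub>v x) = (transpose_mat (A * Q) *\<^sub>v (A * Q *\<^sub>v y)) \<bullet> y"
    unfolding Ax using AQ y by (intro scalar_prod_mult_mat_vec) auto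
  also have "\<dots> = (mat_diag n \<mu> *\<^sub>v y) \<bullet> y"
    using AQ y by (simp add: gram_mult[symmetric] assoc_mult_mat_vec[of _ n m _ n])
  finally show "(A *\<^sub>v x) \<bullet> (A *\<^sub>v x) = (\<Sum>i<n. \<mu> i * (y $ i)\<^sup>2)"
    using y by (simp add: mat_diag_mult_vec scalar_prod_def power2_eq_square atLeast0LessThan mult.assoc)
qed

lemma ex_pseudoinverse: "\<exists>X. is_pseudoinverse A X"
proof
  define B where "B = A * Q"
  \<comment> \<open>As \<open>inverse 0 = 0\<close>, \<open>D\<close> is the pseudoinverse of
    \<open>mat_diag n \<mu>\<close>, and \<open>X\<close> is the least-squares formula
    \<open>(A^T A)^+ A^T\<close> in the basis \<open>Q\<close>.\<close>
  define D where "D = mat_diag n (\<lambda>i. inverse (\<mu> i))"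
  define X where "X = Q * (D * transpose_mat B)"
  have B: "B \<in> carrier_mat m n" using A Q by (simp add: B_def)
  have D: "D \<in> carrier_mat n n" "transpose_mat D = D" by (simp_all add: D_def)
  have BB: "transpose_mat B * B = mat_diag n \<mu>" unfolding B_def by (rule gram_mult)
  have AB: "A = B * transpose_mat Q"
    using A Q by (simp add: B_def assoc_mult_mat[of _ m n _ n _ n] orthogonal')
  \<comment> \<open>Column \<open>j\<close> gets the factor
    \<open>inverse (\<mu> j) * \<mu> j\<close>. This is 1 unless \<open>\<mu> j = 0\<close>, and
    then the column itself is zero.\<close>
  have BDBB: "B * (D * (transpose_mat B * B)) = B"
  proof (rule eq_matI)
    fix i j assume "i < dim_row B" "j < dim_col B"
    then have ij: "i < m" "j < n" using B by auto
    have "D * (transpose_mat B * B) = mat_diag n (\<lambda>i. inverse (\<mu> i) * \<mu> i)"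
      by (simp add: BB D_def)
    then have 1: "(B * (D * (transpose_mat B * B))) $$ (i, j) = B $$ (i, j) * (inverse (\<mu> j) * \<mu> j)"
      using ij B by (simp add: mat_diag_mult_right[of _ m])
    show "(B * (D * (transpose_mat B * B))) $$ (i, j) = B $$ (i, j)"
    proof (cases "\<mu> j = 0")
      case True
      have "col B j \<bullet> col B j = (transpose_mat B * B) $$ (j, j)" using ij B by simp
      also have "\<dots> = 0" using True ij unfolding BB by (simp add: mat_diag_def)
      finally have "col B j = 0\<^sub>v m"
        using real_scalar_prod_self_eq_0_iff[of "col B j" m] B by auto
      then have "B $$ (i, j) = 0" using ij B by (metis index_col index_zero_vec(1) carrier_matD)
      then show ?thesis by (simp add: 1)
    qed (simp add: 1)
  qed (use B D in auto)
  have DBBD: "D * (transpose_mat B * B) * D = D"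
  proof -
    have "inverse (\<mu> i) * \<mu> i * inverse (\<mu> i) = inverse (\<mu> i)" for i
      by (cases "\<mu> i = 0") simp_all
    then show ?thesis unfolding BB D_def mat_diag_diag by (simp only: mult.assoc)
  qed
  have cX: "X \<in> carrier_mat n m" using Q D B by (simp add: X_def)
  have AX: "A * X = B * (D * transpose_mat B)"
  proof -
    have "A * X = B * ((transpose_mat Q * Q) * (D * transpose_mat B))"
      using B D Q unfolding AB X_def
      by (simp add: assoc_mult_mat[of _ m n _ n _ m] assoc_mult_mat[of _ n n _ n _ m])
    also have "transpose_mat Q * Q * (D * transpose_mat B) = D * transpose_mat B"
      unfolding orthogonal using B D by (intro left_mult_one_mat) auto
    finally show ?thesis .
  qed
  have XA: "X * A = Q * (D * (transpose_mat B * B)) * transpose_mat Q"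
    using B D Q unfolding AB X_def
    by (simp add: assoc_mult_mat[of _ n n _ n _ m] assoc_mult_mat[of _ n n _ n _ n]
        assoc_mult_mat[of _ n n _ m _ n] assoc_mult_mat[of _ n m _ n _ n])
  have "A * X * A = B * (D * (transpose_mat B * B)) * transpose_mat Q"
    unfolding AX using B D Q
    by (subst AB) (simp add: assoc_mult_mat[of _ m n _ m _ n] assoc_mult_mat[of _ n n _ m _ n]
        assoc_mult_mat[of _ m n _ n _ n] assoc_mult_mat[of _ n n _ n _ n] assoc_mult_mat[of _ n m _ n _ n])
  then have 1: "A * X * A = A" by (simp only: BDBB AB[symmetric])
  have "X * A * X = X * (A * X)" using A cX by simp
  also have "\<dots> = Q * (D * (transpose_mat B * B) * D * transpose_mat B)"
    unfolding AX unfolding X_def using B D Q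
    by (simp add: assoc_mult_mat[of _ n n _ m _ m] assoc_mult_mat[of _ n m _ n _ m]
        assoc_mult_mat[of _ n n _ n _ m] assoc_mult_mat[of _ n m _ n _ n] assoc_mult_mat[of _ n n _ m _ n])
  also have "\<dots> = X" by (simp add: DBBD X_def)
  finally have 2: "X * A * X = X" .
  \<comment> \<open>Both products are a diagonal matrix between a matrix and its transpose:
    \<open>A * X\<close> with outer factor \<open>B\<close>, \<open>X * A\<close> with outer factor
    \<open>Q\<close>.\<close>
  have 3: "transpose_mat (A * X) = A * X"
    unfolding AX using B D
    by (simp add: transpose_mult[of _ m n _ m] transpose_mult[of _ n n _ m] assoc_mult_mat[of _ m n _ n _ m])
  have "D * (transpose_mat B * B) = mat_diag n (\<lambda>i. inverse (\<mu> i) * \<mu> i)"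
    by (simp add: BB D_def)
  then have 4: "transpose_mat (X * A) = X * A"
    unfolding XA using Q
    by (simp add: transpose_mult[of _ n n _ n] mult_carrier_mat[of _ n n _ n] assoc_mult_mat[of _ n n _ n _ n])
  show "is_pseudoinverse A X"
    using A cX 1 2 3 4 by (auto simp: is_pseudoinverse_def)
qed

section \<open>The two norm bounds for a fixed point\<close>

text \<open>An arbitrary vector \<open>w\<close> stands for \<psi>(u), as only the linear relations
  between \<open>u\<close>, \<open>w\<close> and \<open>k\<close> enter.\<close>

lemma pseudoinverse_fixed_point_bounds:
  fixes u w k :: "real vec"
  assumes u: "u = - (A *\<^sub>v w)" "u \<noteq> 0\<^sub>v m" and u_carrier: "u \<in> carrier_vec m"
    and k: "k \<in> mat_kernel A"
    and w: "w = - (pseudoinverse A *\<^sub>v u) + k"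
  shows "(vec_norm2 u)\<^sup>2 / (singular_value 1 A)\<^sup>2 \<le> (vec_norm2 w)\<^sup>2 - (vec_norm2 k)\<^sup>2"
    and "(vec_norm2 w)\<^sup>2 - (vec_norm2 k)\<^sup>2 \<le> (vec_norm2 u)\<^sup>2 / (singular_value (vec_space.rank m A) A)\<^sup>2"
proof -
  define X where "X = pseudoinverse A"
  have "is_pseudoinverse A X"
    unfolding X_def using ex_pseudoinverse is_pseudoinverse_pseudoinverse by blast
  then have X: "X \<in> carrier_mat n m" "X * A * X = X" "transpose_mat (X * A) = X * A"
    using A by (auto simp: is_pseudoinverse_def)
  define x where "x = - (X *\<^sub>v u)"
  have x: "x \<in> carrier_vec n" using X u_carrier by (simp add: x_def)
  have kc: "k \<in> carrier_vec n" and Ak: "A *\<^sub>v k = 0\<^sub>v m" using mat_kernelD[OF A k] by auto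
  have wxk: "w = x + k" by (simp add: w x_def X_def)
  have ux: "u = - (A *\<^sub>v x)"
    unfolding u(1) wxk using A x kc Ak by (simp add: mult_add_distrib_mat_vec[of _ m n])
  \<comment> \<open>\<open>x\<close> lies in the range of \<open>X\<close>, on which
    \<open>X * A\<close> acts as the identity by \<open>X * A * X = X\<close>.\<close>
  have XA: "X * A *\<^sub>v x = x"
  proof -
    have "X * A * X *\<^sub>v u = X * A *\<^sub>v (X *\<^sub>v u)"
      using X A u_carrier by (intro assoc_mult_mat_vec[of _ n n _ m]) auto
    then have "X * A *\<^sub>v (X *\<^sub>v u) = X *\<^sub>v u" by (simp only: X(2))
    then show ?thesis
      using mult_mat_vec_uminus[of "X *\<^sub>v u" "X * A"] X A u_carrier by (simp add: x_def)
  qed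
  \<comment> \<open>Moving the symmetric matrix \<open>X * A\<close> across the scalar product
    applies \<open>A\<close> to \<open>z\<close>.\<close>
  have orth: "x \<bullet> z = 0" if z: "z \<in> carrier_vec n" "A *\<^sub>v z = 0\<^sub>v m" for z
  proof -
    have "z \<bullet> x = z \<bullet> (X * A *\<^sub>v x)" by (simp add: XA)
    also have "\<dots> = (X * A *\<^sub>v z) \<bullet> x"
      using scalar_prod_mult_mat_vec[of "X * A" n n x z] X A x z by simp
    also have "X * A *\<^sub>v z = 0\<^sub>v n" using X A z by (simp add: assoc_mult_mat_vec[of _ n m _ n]) auto
    finally show ?thesis using x z by (simp add: comm_scalar_prod[of x n z])
  qed
  have "w \<bullet> w = x \<bullet> x + k \<bullet> k"
    using x kc orth[OF kc Ak] comm_scalar_prod[OF kc x]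
    by (simp add: wxk add_scalar_prod_distrib[of _ n] scalar_prod_add_distrib[of _ n])
  then have norm_x: "(vec_norm2 w)\<^sup>2 - (vec_norm2 k)\<^sup>2 = x \<bullet> x" by (simp add: vec_norm2_sq)
  define y where "y = transpose_mat Q *\<^sub>v x"
  have norm_u: "(vec_norm2 u)\<^sup>2 = (\<Sum>i<n. \<mu> i * (y $ i)\<^sup>2)"
    using norm_mult_vec(2)[OF x] A x by (simp add: vec_norm2_sq ux y_def)
  \<comment> \<open>If \<open>\<mu> i = 0\<close>, then column \<open>i\<close> of \<open>Q\<close>
    lies in the kernel of \<open>A\<close>, hence is orthogonal to \<open>x\<close>.\<close>
  have y0: "y $ i = 0" if i: "i < n" "\<not> \<mu> i > 0" for i
  proof -
    have "\<mu> i = 0" using eigenvalue_nonneg[of i] i by simp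
    moreover have "col (A * Q) i = A *\<^sub>v col Q i" by (rule col_mult2[OF A Q i(1)])
    then have "(A *\<^sub>v col Q i) \<bullet> (A *\<^sub>v col Q i) = (transpose_mat (A * Q) * (A * Q)) $$ (i, i)"
      using i A Q by simp
    ultimately have "(A *\<^sub>v col Q i) \<bullet> (A *\<^sub>v col Q i) = 0"
      using i by (simp add: gram_mult) (simp add: mat_diag_def)
    moreover have qc: "col Q i \<in> carrier_vec n" using Q by auto
    ultimately have "A *\<^sub>v col Q i = 0\<^sub>v m"
      using real_scalar_prod_self_eq_0_iff[OF mult_mat_vec_carrier[OF A qc]] by simp
    with qc have "x \<bullet> col Q i = 0" by (intro orth)
    then show ?thesis using i Q qc x by (simp add: y_def comm_scalar_prod[of x n])
  qed
  define s t where "s = singular_value 1 A" and "t = singular_value (vec_space.rank m A) A"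
  note sv = singular_value_bounds[folded s_def t_def]
  \<comment> \<open>A nonzero \<open>u\<close> forces a positive eigenvalue, so both singular values
    are genuine and the divisors below are positive.\<close>
  obtain i where i: "i < n" "\<mu> i > 0"
  proof -
    have "vec_norm2 u \<noteq> 0"
      using real_scalar_prod_self_eq_0_iff[OF u_carrier] u(2) by (simp add: vec_norm2_def)
    then have "(\<Sum>i<n. \<mu> i * (y $ i)\<^sup>2) \<noteq> 0" by (simp flip: norm_u)
    then obtain i where "i < n" "\<mu> i * (y $ i)\<^sup>2 \<noteq> 0" by (meson lessThan_iff sum.not_neutral_contains_not_neutral)
    with y0 that show thesis by fastforce
  qed
  have s1: "s\<^sup>2 > 0" using sv(1)[OF i] i(2) by linarith
  have sr: "t\<^sup>2 > 0" using sv(2)[OF i] by simp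
  \<comment> \<open>Termwise comparison: where \<open>\<mu> i\<close> is not positive,
    \<open>y $ i = 0\<close> and both terms vanish.\<close>
  have "(vec_norm2 u)\<^sup>2 \<le> (\<Sum>i<n. s\<^sup>2 * (y $ i)\<^sup>2)"
    unfolding norm_u
  proof (rule sum_mono)
    fix i assume "i \<in> {..<n}"
    then show "\<mu> i * (y $ i)\<^sup>2 \<le> s\<^sup>2 * (y $ i)\<^sup>2"
      using y0[of i] sv(1)[of i] by (cases "\<mu> i > 0") (auto intro: mult_right_mono)
  qed
  also have "\<dots> = s\<^sup>2 * (x \<bullet> x)"
    by (simp add: norm_mult_vec(1)[OF x] y_def flip: sum_distrib_left)
  finally show "(vec_norm2 u)\<^sup>2 / (singular_value 1 A)\<^sup>2 \<le> (vec_norm2 w)\<^sup>2 - (vec_norm2 k)\<^sup>2"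
    unfolding norm_x using s1 by (simp add: s_def field_simps)
  have "t\<^sup>2 * (x \<bullet> x) = (\<Sum>i<n. t\<^sup>2 * (y $ i)\<^sup>2)"
    by (simp add: norm_mult_vec(1)[OF x] y_def flip: sum_distrib_left)
  also have "\<dots> \<le> (vec_norm2 u)\<^sup>2"
    unfolding norm_u
  proof (rule sum_mono)
    fix i assume "i \<in> {..<n}"
    then show "t\<^sup>2 * (y $ i)\<^sup>2 \<le> \<mu> i * (y $ i)\<^sup>2"
      using y0[of i] sv(3)[of i] by (cases "\<mu> i > 0") (auto intro: mult_right_mono)
  qed
  finally show "(vec_norm2 w)\<^sup>2 - (vec_norm2 k)\<^sup>2 \<le> (vec_norm2 u)\<^sup>2 / (singular_value (vec_space.rank m A) A)\<^sup>2"
    unfolding norm_x using sr by (simp add: t_def field_simps)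
qed

end

section \<open>The Hartley transform\<close>

text \<open>The discrete Hartley transform, scaled to be orthogonal; being also symmetric, it is its
  own inverse.\<close>

definition hartley_mat :: "nat \<Rightarrow> real mat" where
  "hartley_mat P = mat P P (\<lambda>(k, l).
     (cos (2 * pi * real k * real l / real P) + sin (2 * pi * real k * real l / real P)) / sqrt (real P))"

lemma hartley_mat_carrier [simp]: "hartley_mat P \<in> carrier_mat P P"
  by (simp add: hartley_mat_def)

lemma transpose_hartley_mat [simp]: "transpose_mat (hartley_mat P) = hartley_mat P"
  by (rule eq_matI) (auto simp: hartley_mat_def mult_ac)

lemma dft_mat_carrier [simp]: "dft_mat P \<in> carrier_mat P P"
  by (simp add: dft_mat_def)

lemma dft_inv_mat_carrier [simp]: "dft_inv_mat P \<in> carrier_mat P P"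
  by (simp add: dft_inv_mat_def)

text \<open>The reflection of \<open>k\<close> to \<open>P - k\<close> fixes the weights and negates
  the sine, so the sum equals its own negative.\<close>

lemma sum_even_mult_sin_eq_0:
  assumes even: "\<And>k. 0 < k \<Longrightarrow> k < P \<Longrightarrow> \<mu> (P - k) = \<mu> k"
  shows "(\<Sum>k<P. \<mu> k * sin (2 * pi * real k * real n / real P)) = 0"
proof -
  define f where "f = (\<lambda>k. \<mu> k * sin (2 * pi * real k * real n / real P))"
  have f: "f (P - k) = - f k" if k: "0 < k" "k < P" for k
  proof -
    have "2 * pi * real (P - k) * real n / real P = 2 * real n * pi - 2 * pi * real k * real n / real P"
      using k by (simp add: of_nat_diff field_simps)
    then have "sin (2 * pi * real (P - k) * real n / real P) = - sin (2 * pi * real k * real n / real P)"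
      by (simp add: sin_diff sin_2npi cos_2npi del: of_nat_diff)
    then show ?thesis using k by (simp add: f_def even)
  qed
  \<comment> \<open>Index 0 has no partner under the reflection, but its term contains
    \<open>sin 0\<close>.\<close>
  have *: "sum f {..<P} = sum f {1..<P}"
    by (cases "P = 0") (auto simp: f_def lessThan_atLeast0 sum.atLeast_Suc_lessThan)
  also have "sum f {1..<P} = (\<Sum>k = 1..<P. - f k)"
    by (rule sum.reindex_bij_witness[of _ "\<lambda>k. P - k" "\<lambda>k. P - k"]) (auto simp: f[symmetric])
  finally have "sum f {..<P} = - sum f {1..<P}" by (simp add: sum_negf)
  with * have "sum f {..<P} = 0" by simp
  then show ?thesis by (simp add: f_def)
qed

text \<open>By the identity \<open>cas\<close>, each entry splits into a cosine sum, the real part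
  of the Fourier expression, and a sine sum, which vanishes for even weights.\<close>

lemma hartley_mat_conj_diag:
  assumes even: "\<And>k. 0 < k \<Longrightarrow> k < P \<Longrightarrow> \<mu> (P - k) = \<mu> k"
  shows "hartley_mat P * mat_diag P \<mu> * hartley_mat P =
    map_mat Re (dft_inv_mat P * mat_diag P (\<lambda>k. complex_of_real (\<mu> k)) * dft_mat P)"
    (is "?L = ?R")
proof (rule eq_matI)
  fix i j assume "i < dim_row ?R" "j < dim_col ?R"
  then have ij: "i < P" "j < P" by (auto simp: dft_inv_mat_def dft_mat_def)
  define t where "t = (\<lambda>k l. 2 * pi * real k * real l / real P)"
  have cas: "(cos a + sin a) * (cos b + sin b) = cos (a - b) + sin (a + b)" for a b :: real
    by (simp add: cos_diff sin_add algebra_simps)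
  have "?L $$ (i, j) = (\<Sum>k<P. (cos (t i k) + sin (t i k)) / sqrt P * \<mu> k * ((cos (t k j) + sin (t k j)) / sqrt P))"
    using ij by (simp add: mat_diag_mult_right[of _ P] scalar_prod_def hartley_mat_def t_def atLeast0LessThan)
  also have "\<dots> = (\<Sum>k<P. \<mu> k * cos (t i k - t k j) / P + \<mu> k * sin (t k (i + j)) / P)"
  proof (rule sum.cong[OF refl])
    fix k assume "k \<in> {..<P}"
    have "t i k + t k j = t k (i + j)" by (simp add: t_def add_divide_distrib distrib_left mult_ac)
    then have "(cos (t i k) + sin (t i k)) * (cos (t k j) + sin (t k j)) = cos (t i k - t k j) + sin (t k (i + j))"
      unfolding cas by simp
    moreover have "(cos (t i k) + sin (t i k)) / sqrt P * \<mu> k * ((cos (t k j) + sin (t k j)) / sqrt P) =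
      \<mu> k * ((cos (t i k) + sin (t i k)) * (cos (t k j) + sin (t k j))) / P"
      by (simp add: field_simps)
    ultimately show "(cos (t i k) + sin (t i k)) / sqrt P * \<mu> k * ((cos (t k j) + sin (t k j)) / sqrt P) =
      \<mu> k * cos (t i k - t k j) / P + \<mu> k * sin (t k (i + j)) / P"
      by (simp add: algebra_simps add_divide_distrib)
  qed
  also have "\<dots> = (\<Sum>k<P. \<mu> k * cos (t i k - t k j) / P)"
    using sum_even_mult_sin_eq_0[of P \<mu> "i + j"] even
    by (simp add: sum.distrib t_def flip: sum_divide_distrib)
  also have "\<dots> = (\<Sum>k<P. Re (dft_inv_mat P $$ (i, k) * \<mu> k * dft_mat P $$ (k, j)))"
  proof (rule sum.cong[OF refl])
    fix k assume k: "k \<in> {..<P}"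
    have 1: "dft_inv_mat P $$ (i, k) = cis (t i k) / P"
      using ij k by (simp add: dft_inv_mat_def t_def cis_conv_exp mult_ac)
    have 2: "dft_mat P $$ (k, j) = cis (- t k j)"
      using ij k by (simp add: dft_mat_def t_def cis_conv_exp mult_ac)
    have "dft_inv_mat P $$ (i, k) * \<mu> k * dft_mat P $$ (k, j) = (\<mu> k / P) *\<^sub>R (cis (t i k) * cis (- t k j))"
      unfolding 1 2 by (simp add: scaleR_conv_of_real)
    then show "\<mu> k * cos (t i k - t k j) / P = Re (dft_inv_mat P $$ (i, k) * \<mu> k * dft_mat P $$ (k, j))"
      by (simp add: cis_mult)
  qed
  also have "\<dots> = ?R $$ (i, j)"
    using ij carrier_matD[OF dft_mat_carrier, of P] carrier_matD[OF dft_inv_mat_carrier, of P]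
    by (simp add: mat_diag_mult_right[of _ P] scalar_prod_def atLeast0LessThan)
  finally show "?L $$ (i, j) = ?R $$ (i, j)" .
qed (auto simp: hartley_mat_def dft_inv_mat_def dft_mat_def)

text \<open>The constant weight 1 is even, and for it the Fourier side collapses to the
  identity.\<close>

lemma hartley_mat_mult_self:
  assumes "P \<ge> 1"
  shows "hartley_mat P * hartley_mat P = 1\<^sub>m P"
proof -
  have "hartley_mat P * mat_diag P (\<lambda>k. 1) * hartley_mat P =
    map_mat Re (dft_inv_mat P * mat_diag P (\<lambda>k. complex_of_real 1) * dft_mat P)"
    by (rule hartley_mat_conj_diag) simp
  moreover have "dft_inv_mat P * dft_mat P = 1\<^sub>m P"
    using mat_mult_left_right_inverse[OF _ _ dft_mat_mult_dft_inv_mat[OF assms]] by simp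
  moreover have "map_mat Re (1\<^sub>m P) = 1\<^sub>m P" by (rule eq_matI) auto
  ultimately show ?thesis
    by (simp add: right_mult_one_mat[of _ P P])
qed

section \<open>Singular values of the circulant matrix\<close>

definition freq_response :: "nat \<Rightarrow> real poly fract \<Rightarrow> nat \<Rightarrow> complex" where
  "freq_response P G k = rat_eval G (exp (- 2 * of_real pi * \<i> * of_nat k / of_nat P))"

text \<open>The nodes of indices \<open>k\<close> and \<open>P - k\<close> are complex conjugate,
  and \<open>G\<close> has real coefficients. This makes the squared modulus even.\<close>

lemma freq_response_reflect:
  assumes "0 < k" "k < P"
  shows "freq_response P G (P - k) = cnj (freq_response P G k)"
proof -
  have e: "exp (- 2 * of_real pi * \<i> * of_nat l / of_nat P) = cis (- 2 * pi * real l / real P)" for l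
    by (simp add: cis_conv_exp mult_ac)
  have "- 2 * pi * real (P - k) / real P = 2 * pi * real k / real P - 2 * pi"
    using assms by (simp add: of_nat_diff field_simps)
  then have "cis (- 2 * pi * real (P - k) / real P) = cis (2 * pi * real k / real P)"
    by (simp add: cis_divide[symmetric])
  then show ?thesis
    unfolding freq_response_def e cnj_rat_eval by (simp add: cis_cnj)
qed

lemma circulant_mat_carrier:
  assumes "P \<ge> 1"
  shows "circulant_mat P G \<in> carrier_mat P P"
  unfolding circulant_mat_def circulant_complex_def mat_inverse_dft_mat[OF assms]
  by (auto simp: dft_diag_def intro!: mult_carrier_mat[of _ P P])

text \<open>Since \<open>C\<close> is real, it equals its conjugate \<open>F * L cnj * F'\<close>.
  Transposing that form gives \<open>C^T C = F' |L|^2 F\<close>, whose even real weights allow the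
  passage to the Hartley basis.\<close>

lemma gram_circulant_mat:
  assumes P: "P \<ge> 1"
  shows "transpose_mat (circulant_mat P G) * circulant_mat P G =
    hartley_mat P * mat_diag P (\<lambda>k. (cmod (freq_response P G k))\<^sup>2) * hartley_mat P"
proof -
  define F F' where "F = dft_mat P" and "F' = dft_inv_mat P"
  define L where "L = (\<lambda>f. mat_diag P (\<lambda>k. f (freq_response P G k) :: complex))"
  define C where "C = circulant_complex P G"
  have c [simp]: "F \<in> carrier_mat P P" "F' \<in> carrier_mat P P" "L f \<in> carrier_mat P P" for f
    by (simp_all add: F_def F'_def L_def)
  note assoc = assoc_mult_mat[of _ P P _ P _ P]
  interpret cnj: semiring_hom cnj by unfold_locales simp_all
  have FF': "F * F' = 1\<^sub>m P" unfolding F_def F'_def by (rule dft_mat_mult_dft_inv_mat[OF P])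
  have C: "C = F' * L (\<lambda>z. z) * F"
    unfolding C_def circulant_complex_def mat_inverse_dft_mat[OF P]
    by (simp add: F_def F'_def L_def dft_diag_def freq_response_def)
  have sym: "transpose_mat F = F" "transpose_mat F' = F'"
    by (auto simp: F_def F'_def dft_mat_def dft_inv_mat_def mult_ac)
  \<comment> \<open>Conjugation reverses the sign of the exponent; the scalars appear because only
    \<open>F'\<close> carries the factor \<open>1 / P\<close>, and they cancel in the
    product.\<close>
  have cnj_F: "map_mat cnj F = of_nat P \<cdot>\<^sub>m F'" and cnj_F': "map_mat cnj F' = inverse (of_nat P) \<cdot>\<^sub>m F"
  proof -
    have e: "exp (2 * of_real pi * \<i> * of_nat k * of_nat l / of_nat P) = cis (2 * pi * real k * real l / real P)"
      and e': "exp (- 2 * of_real pi * \<i> * of_nat k * of_nat l / of_nat P) = cis (- (2 * pi * real k * real l / real P))"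
      for k l by (simp_all add: cis_conv_exp mult_ac)
    show "map_mat cnj F = of_nat P \<cdot>\<^sub>m F'" and "map_mat cnj F' = inverse (of_nat P) \<cdot>\<^sub>m F"
      unfolding F_def F'_def dft_mat_def dft_inv_mat_def e e'
      using P by (auto simp: cis_cnj divide_inverse intro!: eq_matI)
  qed
  have cnj_L: "map_mat cnj (L (\<lambda>z. z)) = L cnj"
    by (rule eq_matI) (auto simp: L_def mat_diag_def)
  have smult_inverse: "of_nat P \<cdot>\<^sub>m (inverse (of_nat P) \<cdot>\<^sub>m M) = M" for M :: "complex mat"
    using P by (intro eq_matI) auto
  have C_real: "C = map_mat complex_of_real (circulant_mat P G)"
    unfolding C_def by (rule map_mat_of_real_circulant_mat[OF P, symmetric])
  have "C = map_mat cnj C" unfolding C_real by (rule eq_matI) auto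
  also have "\<dots> = map_mat cnj F' * map_mat cnj (L (\<lambda>z. z)) * map_mat cnj F"
    unfolding C by (simp add: cnj.mat_hom_mult[of _ P P _ P] mult_carrier_mat[of _ P P _ P])
  also have "\<dots> = F * L cnj * F'"
    unfolding cnj_F cnj_F' cnj_L using P
    by (simp add: mult_smult_assoc_mat[of _ P P _ P] mult_smult_distrib[of _ P P _ P]
        mult_carrier_mat[of _ P P _ P] smult_inverse)
  finally have C': "C = F * L cnj * F'" .
  \<comment> \<open>The conjugated form is used for the transposed factor only, so that
    \<open>F\<close> and \<open>F'\<close> meet in the middle and cancel.\<close>
  have "transpose_mat C * C = (F' * (L cnj * F)) * (F' * (L (\<lambda>z. z) * F))"
    by (subst C', subst C) (simp add: transpose_mult[of _ P P _ P] sym L_def assoc mult_carrier_mat[of _ P P _ P])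
  also have "\<dots> = F' * (L cnj * (F * F') * L (\<lambda>z. z)) * F"
    by (simp add: assoc mult_carrier_mat[of _ P P _ P])
  also have "L cnj * (F * F') * L (\<lambda>z. z) = mat_diag P (\<lambda>k. complex_of_real ((cmod (freq_response P G k))\<^sup>2))"
    unfolding FF' by (simp del: of_real_power add: right_mult_one_mat[of _ P P] L_def complex_norm_square mult.commute)
  finally have CC: "transpose_mat C * C =
    F' * mat_diag P (\<lambda>k. complex_of_real ((cmod (freq_response P G k))\<^sup>2)) * F" .
  have "hartley_mat P * mat_diag P (\<lambda>k. (cmod (freq_response P G k))\<^sup>2) * hartley_mat P =
    map_mat Re (transpose_mat C * C)"
    unfolding CC F_def F'_def
    by (rule hartley_mat_conj_diag) (simp add: freq_response_reflect)
  also have "transpose_mat C * C = map_mat complex_of_real (transpose_mat (circulant_mat P G) * circulant_mat P G)"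
    unfolding C_real using circulant_mat_carrier[OF P, of G]
    by (simp add: of_real_hom.mat_hom_mult[of _ P P _ P] map_mat_transpose)
  also have "map_mat Re \<dots> = transpose_mat (circulant_mat P G) * circulant_mat P G"
    by (rule eq_matI) auto
  finally show ?thesis ..
qed

lemma circulant_gram_diagonalization:
  assumes "P \<ge> 1"
  shows "gram_diagonalization P P (circulant_mat P G) (hartley_mat P)
    (\<lambda>k. (cmod (freq_response P G k))\<^sup>2)"
  using circulant_mat_carrier[OF assms] hartley_mat_mult_self[OF assms] gram_circulant_mat[OF assms]
  by unfold_locales simp_all

theorem lemma1:
  fixes P r :: nat and g :: "nat \<Rightarrow> real" and G :: "real poly fract" and \<psi> :: "real \<Rightarrow> real"
    and H :: "real mat" and u u_ker :: "real vec"
  assumes "P \<ge> 1"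
    and "is_transfer_function g G"
    and "g \<noteq> (\<lambda>t. 0)"
    and "\<And>z. z ^ P = 1 \<Longrightarrow> \<not> rat_pole G z"
    and "H = circulant_mat P G"
    and "r = vec_space.rank P H"
    and "u \<in> carrier_vec P" and "u \<noteq> 0\<^sub>v P"
    and "u = - (H *\<^sub>v map_vec \<psi> u)"
    and "u_ker \<in> mat_kernel H"
    and "map_vec \<psi> u = - (pseudoinverse H *\<^sub>v u) + u_ker"
  shows "(vec_norm2 u)\<^sup>2 / (singular_value 1 H)\<^sup>2 \<le> (vec_norm2 (map_vec \<psi> u))\<^sup>2 - (vec_norm2 u_ker)\<^sup>2 \<and>
    (vec_norm2 (map_vec \<psi> u))\<^sup>2 - (vec_norm2 u_ker)\<^sup>2 \<le> (vec_norm2 u)\<^sup>2 / (singular_value r H)\<^sup>2"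
proof -
  interpret gram_diagonalization P P H "hartley_mat P" "\<lambda>k. (cmod (freq_response P G k))\<^sup>2"
    unfolding assms(5) by (rule circulant_gram_diagonalization[OF assms(1)])
  show ?thesis
    \<comment> \<open>The vector \<open>map_vec \<psi> u\<close> takes the place of
      \<open>w\<close>.\<close>
    unfolding assms(6)
    using pseudoinverse_fixed_point_bounds[OF assms(9,8,7,10,11)] by blast
qed

end
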